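(* For all $K\in\mathcal{K}$, $\tau\in\mathbb{H}$ and $z\in\mathbb{C}$ with $z\notin\mathbb{Z}\tau+\mathbb{Z}$, the $K$-summation $\wp(K,z)$ is defined (that is, the limit defining it exists) and satisfies $$\wp(K,z)=\wp(z)+G_2(\tau)+E(K,\tau).$$
   Context: $\mathbb{H}=\{\tau\in\mathbb{C}:\operatorname{Im}(\tau)>0\}$ is the upper half-plane. The weight-2 Eisenstein series is $$G_2(\tau)=\sum_{m\in\mathbb{Z}}\Big[\sum_{n\in\mathbb{Z}}\frac{1}{(n+m\tau)^2}\Big],$$ summed in the indicated order (inner sum over $n$, then outer sum over $m$), with the term $(m,n)=(0,0)$ omitted. The Weierstrass $\wp$-function (its dependence on $\tau\in\mathbb{H}$ is suppressed in the notation) is $$\wp(z)=\frac{1}{z^2}+\sum_{(m,n)\in\mathbb{Z}^2\setminus\{(0,0)\}}\left[\frac{1}{(z+n+m\tau)^2}-\frac{1}{(n+m\tau)^2}\right],\qquad z\notin\mathbb{Z}\tau+\mathbb{Z},$$ the sum being absolutely convergent. $\mathcal{K}$ denotes the class of compact convex sets $K\subset\mathbb{R}^2$ with nonempty interior that are symmetric about the $x$-axis and about the $y$-axis (i.e. $(x,y)\in K$ implies $(-x,y)\in K$ and $(x,-y)\in K$). For an array $(a_{m,n})_{m,n\in\mathbb{Z}}$ of complex numbers and $K\in\mathcal{K}$, the $K$-summation is $$\sum_K a_{m,n}:=\lim_{\lambda\to\infty}\ \sum_{(m,n)\in(\lambda K)\cap\mathbb{Z}^2}a_{m,n},$$ provided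 the limit exists, where $\lambda>0$ is real and $\lambda K=\{\lambda p:p\in K\}$ (so $m$ is the $x$-coordinate and $n$ the $y$-coordinate). Define $G_2(K,\tau):=\sum_K\frac{1}{(m\tau+n)^2}$ with the convention $a_{0,0}=0$ (this limit exists for all $K\in\mathcal{K}$ and $\tau\in\mathbb{H}$), and the residual function $E(K,\tau):=G_2(K,\tau)-G_2(\tau)$. The $K$-summation of the Weierstrass $\wp$-function is $$\wp(K,z):=\sum_K\frac{1}{(z+n+m\tau)^2}\qquad(z\notin\mathbb{Z}\tau+\mathbb{Z}),$$ provided the limit exists (here the term $(m,n)=(0,0)$ is included). *)

theory Defs
  imports "HOL-Analysis.Analysis"
begin

definition period_lattice :: "complex \<Rightarrow> complex set" where
  "period_lattice \<tau> = {of_int m * \<tau> + of_int n | m n :: int. True}"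

text \<open>
  The inner sums converge absolutely, and so does the outer sum over \<open>m\<close>; only the sum over all
  pairs is conditionally convergent. Hence \<^const>\<open>infsum\<close> is adequate at both levels.
\<close>

definition eisenstein_G2 :: "complex \<Rightarrow> complex" where
  "eisenstein_G2 \<tau> =
     (\<Sum>\<^sub>\<infinity>m\<in>(UNIV :: int set). \<Sum>\<^sub>\<infinity>n\<in>{n :: int. (m, n) \<noteq> (0, 0)}.
        1 / (of_int n + of_int m * \<tau>)\<^sup>2)"

definition weierstrass_p :: "complex \<Rightarrow> complex \<Rightarrow> complex" where
  "weierstrass_p \<tau> z = 1 / z\<^sup>2 +
     (\<Sum>\<^sub>\<infinity>(m, n)\<in>UNIV - {(0 :: int, 0 :: int)}.
        1 / (z + of_int n + of_int m * \<tau>)\<^sup>2 - 1 / (of_int n + of_int m * \<tau>)\<^sup>2)"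

definition symmetric_convex_bodies :: "(real \<times> real) set set" where
  "symmetric_convex_bodies =
     {K. compact K \<and> convex K \<and> interior K \<noteq> {} \<and>
         (\<forall>x y. (x, y) \<in> K \<longrightarrow> (- x, y) \<in> K \<and> (x, - y) \<in> K)}"

definition dilated_lattice_points :: "(real \<times> real) set \<Rightarrow> real \<Rightarrow> (int \<times> int) set" where
  "dilated_lattice_points K l = {(m, n). (of_int m, of_int n) \<in> (\<lambda>p. l *\<^sub>R p) ` K}"

text \<open>Finiteness guarantees that the partial sums in \<open>K_partial_sum\<close> below are genuine.\<close>

lemma finite_dilated_lattice_points:
  assumes "bounded K"
  shows "finite (dilated_lattice_points K l)"
proof -
  have "bounded ((\<lambda>p. l *\<^sub>R p) ` K)"
    using assms by (rule bounded_scaling)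
  then obtain B where B: "\<And>p. p \<in> (\<lambda>p. l *\<^sub>R p) ` K \<Longrightarrow> norm p \<le> B"
    unfolding bounded_iff by blast
  have "dilated_lattice_points K l \<subseteq> {- \<lceil>B\<rceil>..\<lceil>B\<rceil>} \<times> {- \<lceil>B\<rceil>..\<lceil>B\<rceil>}"
  proof
    fix q assume "q \<in> dilated_lattice_points K l"
    then obtain m n where q: "q = (m, n)"
      and "(real_of_int m, real_of_int n) \<in> (\<lambda>p. l *\<^sub>R p) ` K"
      unfolding dilated_lattice_points_def by blast
    then have "norm (real_of_int m, real_of_int n) \<le> B"
      using B by blast
    then have "\<bar>real_of_int m\<bar> \<le> B" "\<bar>real_of_int n\<bar> \<le> B"
      using norm_fst_le[of "real_of_int m" "real_of_int n"]
        norm_snd_le[of "real_of_int n" "real_of_int m"]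
      by auto
    then show "q \<in> {- \<lceil>B\<rceil>..\<lceil>B\<rceil>} \<times> {- \<lceil>B\<rceil>..\<lceil>B\<rceil>}"
      unfolding q by (simp; linarith)
  qed
  then show ?thesis
    by (rule finite_subset) simp
qed

definition K_partial_sum ::
    "(real \<times> real) set \<Rightarrow> (int \<Rightarrow> int \<Rightarrow> complex) \<Rightarrow> real \<Rightarrow> complex" where
  "K_partial_sum K a l = (\<Sum>(m, n)\<in>dilated_lattice_points K l. a m n)"

definition K_summable :: "(real \<times> real) set \<Rightarrow> (int \<Rightarrow> int \<Rightarrow> complex) \<Rightarrow> bool" where
  "K_summable K a \<longleftrightarrow> (\<exists>L. (K_partial_sum K a \<longlongrightarrow> L) at_top)"

text \<open>Meaningful only if \<^term>\<open>K_summable K a\<close> holds.\<close>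

definition K_sum :: "(real \<times> real) set \<Rightarrow> (int \<Rightarrow> int \<Rightarrow> complex) \<Rightarrow> complex" where
  "K_sum K a = Lim at_top (K_partial_sum K a)"

definition eisenstein_G2_K :: "(real \<times> real) set \<Rightarrow> complex \<Rightarrow> complex" where
  "eisenstein_G2_K K \<tau> =
     K_sum K (\<lambda>m n. if (m, n) = (0, 0) then 0 else 1 / (of_int m * \<tau> + of_int n)\<^sup>2)"

definition residual_E :: "(real \<times> real) set \<Rightarrow> complex \<Rightarrow> complex" where
  "residual_E K \<tau> = eisenstein_G2_K K \<tau> - eisenstein_G2 \<tau>"

definition weierstrass_terms :: "complex \<Rightarrow> complex \<Rightarrow> int \<Rightarrow> int \<Rightarrow> complex" where
  "weierstrass_terms \<tau> z m n = 1 / (z + of_int n + of_int m * \<tau>)\<^sup>2"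

definition weierstrass_p_K :: "(real \<times> real) set \<Rightarrow> complex \<Rightarrow> complex \<Rightarrow> complex" where
  "weierstrass_p_K K \<tau> z = K_sum K (weierstrass_terms \<tau> z)"

end

theory Submission
  imports Defs
begin

text \<open>
  Write \<open>w = m * \<tau> + n\<close>. The differences \<open>1 / (z + w)\<^sup>2 - 1 / w\<^sup>2\<close> decay like \<open>\<bar>w\<bar>\<^sup>-\<^sup>3\<close>, so they
  form an absolutely convergent family whose total, with the contribution \<open>1 / z\<^sup>2\<close> of the origin, is
  \<open>\<wp>(z)\<close>. The dilates of \<open>K\<close> exhaust the lattice, so \<open>K\<close>-summation assigns this family the same total
  (\<open>K_partial_sum_tendsto_infsum\<close>). Everything therefore reduces to the fact that the \<open>K\<close>-summation
  of the conditionally convergent family \<open>1 / w\<^sup>2\<close> has a limit: once this limit exists, it is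
  \<open>G\<^sub>2(K, \<tau>) = G\<^sub>2(\<tau>) + E(K, \<tau>)\<close> by the definition of \<open>E\<close>.

  For the existence of the limit (\<open>eisenstein_terms_K_summable\<close>), replace \<open>1 / w\<^sup>2\<close> by
  \<open>1 / (w - 1/2) - 1 / (w + 1/2) = 1 / (w\<^sup>2 - 1/4)\<close>. The error is again absolutely summable, and
  the new terms telescope along rows of constant \<open>m\<close>. By symmetry and convexity
  \<open>K = {(x, y). \<bar>x\<bar> \<le> a \<and> \<bar>y\<bar> \<le> h x}\<close> with \<open>h\<close> concave, so the row of \<open>m\<close> in \<open>l K\<close> is a symmetric
  interval \<open>{- N..N}\<close> with \<open>N = \<lfloor>l * h (m / l)\<rfloor>\<close>, and its sum is \<open>k m (N + 1/2)\<close> where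
  \<open>k x y = 1 / (x * \<tau> - y) - 1 / (x * \<tau> + y)\<close> is homogeneous of degree \<open>-1\<close>. Thus the whole sum is a
  Riemann sum of mesh \<open>1 / l\<close> for \<open>x \<mapsto> k x (h x)\<close> on \<open>{- a..a}\<close>. The singularity of \<open>k\<close> at the origin
  is harmless because \<open>(x, h x)\<close> stays on the boundary of \<open>K\<close>, away from the origin; hence the Riemann
  sums converge to the integral (\<open>telescoped_terms_K_summable\<close>).
\<close>

section \<open>Absolutely convergent lattice sums\<close>

text \<open>All estimates below use this comparison of the lattice norm with the coordinates: the imaginary
  part of \<open>w = x * \<tau> + y\<close> controls \<open>x\<close>, and then \<open>y = w - x * \<tau>\<close> is controlled as well.\<close>

lemma abs_coords_le_norm:
  fixes \<tau> :: complex
  assumes "Im \<tau> > 0"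
  obtains B where "B > 0"
    and "\<And>x y :: real. \<bar>x\<bar> + \<bar>y\<bar> \<le> B * norm (of_real x * \<tau> + of_real y)"
proof
  show "(1 + norm \<tau>) / Im \<tau> + 1 > 0"
    using assms by (simp add: add_pos_nonneg)
  fix x y :: real
  define w where "w = of_real x * \<tau> + of_real y"
  have "\<bar>x\<bar> * Im \<tau> = \<bar>Im w\<bar>"
    using assms by (simp add: w_def abs_mult)
  also have "\<dots> \<le> norm w"
    by (rule abs_Im_le_cmod)
  finally have x: "\<bar>x\<bar> \<le> norm w / Im \<tau>"
    using assms by (simp add: field_simps)
  have "\<bar>y\<bar> = norm (w - of_real x * \<tau>)"
    by (simp add: w_def)
  also have "\<dots> \<le> norm w + \<bar>x\<bar> * norm \<tau>"
    by (metis norm_triangle_ineq4 norm_mult norm_of_real)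
  also have "\<dots> \<le> norm w + norm w / Im \<tau> * norm \<tau>"
    using x by (intro add_left_mono mult_right_mono) auto
  finally have "\<bar>x\<bar> + \<bar>y\<bar> \<le> norm w / Im \<tau> + (norm w + norm w / Im \<tau> * norm \<tau>)"
    using x by linarith
  also have "\<dots> = ((1 + norm \<tau>) / Im \<tau> + 1) * norm w"
    using assms by (simp add: field_simps)
  finally show "\<bar>x\<bar> + \<bar>y\<bar> \<le> ((1 + norm \<tau>) / Im \<tau> + 1) * norm (of_real x * \<tau> + of_real y)"
    unfolding w_def .
qed

lemma of_real_linear_combination_nonzero:
  fixes x y :: real
  assumes "Im \<tau> > 0" "x \<noteq> 0 \<or> y \<noteq> 0"
  shows "of_real x * \<tau> + of_real y \<noteq> 0"
proof -
  obtain B where B: "\<bar>x\<bar> + \<bar>y\<bar> \<le> B * norm (of_real x * \<tau> + of_real y)"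
    using abs_coords_le_norm[OF assms(1)] by metis
  show ?thesis
  proof
    assume "of_real x * \<tau> + of_real y = 0"
    then have "\<bar>x\<bar> + \<bar>y\<bar> \<le> 0"
      using B by simp
    with assms(2) show False
      by auto
  qed
qed

lemma summable_on_int_powr:
  "(\<lambda>m::int. (1 + \<bar>real_of_int m\<bar>) powr (- 3 / 2)) summable_on UNIV" (is "?f summable_on UNIV")
proof -
  have *: "summable (\<lambda>n. real (Suc n) powr (- 3 / 2))"
    using summable_real_powr_iff[of "-3/2"] summable_Suc_iff[of "\<lambda>n. real n powr (-3/2)"] by simp
  have 1: "?f summable_on range int"
    using * by (subst summable_on_reindex)
      (auto intro!: summable_nonneg_imp_summable_on simp: o_def inj_on_def)
  have 2: "?f summable_on range (\<lambda>n. - int n - 1)"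
    using summable_ignore_initial_segment[OF *, of 1]
    by (subst summable_on_reindex)
      (auto intro!: summable_nonneg_imp_summable_on simp: o_def inj_on_def add_ac)
  have U: "UNIV = range int \<union> range (\<lambda>n. - int n - 1)"
  proof -
    have "m \<in> range int \<union> range (\<lambda>n. - int n - 1)" for m :: int
    proof (cases "m \<ge> 0")
      case True
      then have "m = int (nat m)" by simp
      then show ?thesis by blast
    next
      case False
      then have "m = - int (nat (- m - 1)) - 1" by simp
      then show ?thesis by blast
    qed
    then show ?thesis by blast
  qed
  show ?thesis
    unfolding U by (rule summable_on_Un_disjoint[OF 1 2]) auto
qed

text \<open>A two-dimensional series with cubic decay is dominated by a product of two convergent
  one-dimensional ones, since \<open>(1 + \<bar>m\<bar>) * (1 + \<bar>n\<bar>) \<le> (1 + \<bar>m\<bar> + \<bar>n\<bar>)\<^sup>2\<close>.\<close>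

lemma summable_on_int_pairs_cubic:
  "(\<lambda>(m::int, n::int). 1 / (1 + \<bar>real_of_int m\<bar> + \<bar>real_of_int n\<bar>) ^ 3) summable_on UNIV"
proof (rule summable_on_comparison_test)
  let ?f = "\<lambda>m::int. (1 + \<bar>real_of_int m\<bar>) powr (- 3 / 2)"
  have "(\<lambda>(m, n). ?f m * ?f n) summable_on (UNIV \<times> UNIV)"
  proof (rule summable_on_SigmaI)
    show "((\<lambda>n. case (m, n) of (m, n) \<Rightarrow> ?f m * ?f n) has_sum ?f m * infsum ?f UNIV) UNIV" for m
      unfolding split using summable_on_int_powr
      by (intro has_sum_cmult_right has_sum_infsum)
    show "(\<lambda>m. ?f m * infsum ?f UNIV) summable_on UNIV"
      by (intro summable_on_cmult_left summable_on_int_powr)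
  qed auto
  then show "(\<lambda>(m, n). ?f m * ?f n) summable_on UNIV"
    by simp
  fix p :: "int \<times> int"
  obtain m n where p: "p = (m, n)" by force
  define a b where "a = \<bar>real_of_int m\<bar>" and "b = \<bar>real_of_int n\<bar>"
  have ab: "a \<ge> 0" "b \<ge> 0" by (auto simp: a_def b_def)
  have "(1 + a + b) ^ 3 = ((1 + a + b)\<^sup>2) powr (3 / 2)"
    using ab by (simp add: powr_powr flip: powr_numeral)
  moreover have "((1 + a) * (1 + b)) powr (3 / 2) \<le> ((1 + a + b)\<^sup>2) powr (3 / 2)"
    using ab by (intro powr_mono2) (auto simp: power2_eq_square algebra_simps)
  ultimately have "1 / (1 + a + b) ^ 3 \<le> 1 / ((1 + a) * (1 + b)) powr (3 / 2)"
    using ab by (intro divide_left_mono) (auto intro!: mult_pos_pos)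
  also have "\<dots> = ?f m * ?f n"
    using ab by (simp add: powr_mult powr_minus divide_simps a_def b_def)
  finally show "(case p of (m, n) \<Rightarrow> 1 / (1 + \<bar>real_of_int m\<bar> + \<bar>real_of_int n\<bar>) ^ 3)
      \<le> (case p of (m, n) \<Rightarrow> ?f m * ?f n)"
    by (simp add: p a_def b_def)
qed (auto split: prod.splits)

text \<open>Only finitely many lattice points lie in a disc, so a bound valid outside a disc suffices.\<close>

lemma lattice_summable_cubic_decay:
  fixes f :: "int \<times> int \<Rightarrow> complex"
  assumes "Im \<tau> > 0"
    and decay: "\<And>m n. R \<le> norm (of_int m * \<tau> + of_int n) \<Longrightarrow>
      norm (f (m, n)) \<le> C / norm (of_int m * \<tau> + of_int n) ^ 3"
  shows "f summable_on UNIV"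
proof -
  obtain B where B: "B > 0"
    and coords: "\<And>x y :: real. \<bar>x\<bar> + \<bar>y\<bar> \<le> B * norm (of_real x * \<tau> + of_real y)"
    using abs_coords_le_norm[OF assms(1)] by metis
  have coords: "\<bar>real_of_int m\<bar> + \<bar>real_of_int n\<bar> \<le> B * norm (of_int m * \<tau> + of_int n)" for m n
    using coords[of "of_int m" "of_int n"] by simp
  define F where "F = {(m, n). norm (of_int m * \<tau> + of_int n) < max R 1}"
  define k where "k = \<lceil>B * max R 1\<rceil>"
  have "F \<subseteq> {- k..k} \<times> {- k..k}"
  proof
    fix p assume "p \<in> F"
    then obtain m n where p: "p = (m, n)" and w: "norm (of_int m * \<tau> + of_int n) < max R 1"
      by (auto simp: F_def)
    have "B * norm (of_int m * \<tau> + of_int n) \<le> B * max R 1"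
      using w B by (intro mult_left_mono) auto
    with coords[of m n] have "\<bar>real_of_int m\<bar> + \<bar>real_of_int n\<bar> \<le> of_int k"
      unfolding k_def by linarith
    then show "p \<in> {- k..k} \<times> {- k..k}"
      unfolding p by auto
  qed
  then have F: "finite F"
    by (rule finite_subset) simp
  define g where
    "g = (\<lambda>(m::int, n::int). 1 / (1 + \<bar>real_of_int m\<bar> + \<bar>real_of_int n\<bar>) ^ 3)"
  have "g summable_on UNIV"
    unfolding g_def by (rule summable_on_int_pairs_cubic)
  then have "(\<lambda>p. \<bar>C\<bar> * (2 * B) ^ 3 * g p) summable_on UNIV - F"
    using F by (intro summable_on_cmult_right summable_on_cofin_subset)
  then have "(\<lambda>p. norm (f p)) summable_on UNIV - F"
  proof (rule Infinite_Sum.abs_summable_on_comparison_test')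
    fix p assume p: "p \<in> UNIV - F"
    obtain m n where mn: "p = (m, n)" by force
    define w where "w = of_int m * \<tau> + of_int n"
    have w: "norm w \<ge> R" "norm w \<ge> 1"
      using p by (auto simp: F_def mn w_def)
    have "(m, n) \<noteq> (0, 0)"
      using w by (auto simp: w_def)
    then have "1 \<le> \<bar>real_of_int m\<bar> + \<bar>real_of_int n\<bar>"
      by auto
    then have "1 + \<bar>real_of_int m\<bar> + \<bar>real_of_int n\<bar> \<le> 2 * B * norm w"
      using coords[of m n] unfolding w_def by linarith
    then have "(1 + \<bar>real_of_int m\<bar> + \<bar>real_of_int n\<bar>) ^ 3 \<le> (2 * B * norm w) ^ 3"
      by (intro power_mono) auto
    moreover have "norm w ^ 3 > 0"
      using w by (intro zero_less_power) linarith
    moreover have "(1 + \<bar>real_of_int m\<bar> + \<bar>real_of_int n\<bar>) ^ 3 > 0"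
      by (intro zero_less_power) linarith
    ultimately have "1 / norm w ^ 3 \<le> (2 * B) ^ 3 * g p"
      by (simp add: g_def mn divide_simps mult_ac)
    then have "\<bar>C\<bar> * (1 / norm w ^ 3) \<le> \<bar>C\<bar> * ((2 * B) ^ 3 * g p)"
      by (intro mult_left_mono) auto
    moreover have "norm (f p) \<le> \<bar>C\<bar> / norm w ^ 3"
      using decay[of m n] w unfolding mn w_def
      by (meson abs_ge_self divide_right_mono norm_ge_zero order_trans zero_le_power)
    ultimately show "norm (f p) \<le> \<bar>C\<bar> * (2 * B) ^ 3 * g p"
      by (simp add: mult_ac)
  qed
  then have "f summable_on UNIV - F"
    by (rule Infinite_Sum.abs_summable_summable)
  moreover have "f summable_on F"
    using F by simp
  ultimately have "f summable_on (UNIV - F) \<union> F"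
    by (rule summable_on_Un_disjoint) auto
  then show ?thesis
    by simp
qed

text \<open>At the origin the second term is \<open>1 / 0 = 0\<close>, so the family contributes \<open>1 / z\<^sup>2\<close> there: its sum
  over the whole lattice is the \<open>\<wp>\<close>-function.\<close>

lemma weierstrass_difference_summable:
  assumes "Im \<tau> > 0"
  shows "(\<lambda>(m, n). 1 / (z + of_int n + of_int m * \<tau>)\<^sup>2 - 1 / (of_int n + of_int m * \<tau>)\<^sup>2)
    summable_on UNIV"
proof (rule lattice_summable_cubic_decay[OF assms])
  fix m n :: int
  define w where "w = of_int m * \<tau> + of_int n"
  assume "2 * norm z + 1 \<le> norm (of_int m * \<tau> + of_int n)"
  then have z: "2 * norm z + 1 \<le> norm w"
    by (simp add: w_def)
  then have w: "norm w > 0"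
    using norm_ge_zero[of z] by linarith
  \<comment> \<open>Since \<open>\<bar>w\<bar> \<ge> 2 * \<bar>z\<bar>\<close>, both \<open>\<bar>z + w\<bar>\<close> and \<open>\<bar>2 * w + z\<bar>\<close> are comparable to \<open>\<bar>w\<bar>\<close>.\<close>
  have zw: "norm w / 2 \<le> norm (z + w)"
    using z norm_triangle_ineq2[of w "- z"] by (simp add: add.commute)
  then have zw0: "z + w \<noteq> 0"
    using w by auto
  have "1 / (z + w)\<^sup>2 - 1 / w\<^sup>2 = - (z * (2 * w + z)) / (w\<^sup>2 * (z + w)\<^sup>2)"
    using w zw0 by (simp add: divide_simps) algebra
  then have "norm (1 / (z + w)\<^sup>2 - 1 / w\<^sup>2) =
      norm z * norm (2 * w + z) / (norm w ^ 2 * norm (z + w) ^ 2)"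
    by (simp add: norm_mult norm_divide norm_power)
  also have "\<dots> \<le> norm z * (3 * norm w) / (norm w ^ 2 * (norm w / 2) ^ 2)"
  proof (intro frac_le mult_mono power_mono zw)
    show "norm (2 * w + z) \<le> 3 * norm w"
      using z norm_triangle_ineq[of "2 * w" z] norm_ge_zero[of z]
      unfolding norm_mult norm_numeral by linarith
  qed (use w in auto)
  also have "\<dots> = 12 * norm z / norm w ^ 3"
    using w by (simp add: divide_simps power2_eq_square power3_eq_cube)
  finally show "norm (case (m, n) of (m, n) \<Rightarrow>
      1 / (z + of_int n + of_int m * \<tau>)\<^sup>2 - 1 / (of_int n + of_int m * \<tau>)\<^sup>2)
      \<le> 12 * norm z / norm (of_int m * \<tau> + of_int n) ^ 3"
    by (simp add: w_def add_ac)
qed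

text \<open>Both families agree to leading order: the difference is \<open>- 1/4\<close> divided by \<open>w\<^sup>2 * (w\<^sup>2 - 1/4)\<close>.
  This permits trading \<open>1 / w\<^sup>2\<close> for terms that telescope in \<open>n\<close> at the cost of an absolutely
  convergent series.\<close>

lemma telescoping_difference_summable:
  assumes "Im \<tau> > 0"
  shows "(\<lambda>(m, n). 1 / (of_int m * \<tau> + of_int n)\<^sup>2 -
      (1 / (of_int m * \<tau> + of_int n - 1 / 2) - 1 / (of_int m * \<tau> + of_int n + 1 / 2)))
    summable_on UNIV"
proof (rule lattice_summable_cubic_decay[OF assms])
  fix m n :: int
  define w where "w = of_int m * \<tau> + of_int n"
  assume "1 \<le> norm (of_int m * \<tau> + of_int n)"
  then have w: "norm w \<ge> 1"
    by (simp add: w_def)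
  have 1: "norm w / 2 \<le> norm (w - 1 / 2)"
    using w norm_triangle_ineq2[of w "1 / 2"] by simp
  have 2: "norm w / 2 \<le> norm (w + 1 / 2)"
    using w norm_triangle_ineq2[of w "- 1 / 2"] by simp
  have "norm w > 0" "norm (w - 1 / 2) > 0" "norm (w + 1 / 2) > 0"
    using w 1 2 by linarith+
  then have nz: "w \<noteq> 0" "w - 1 / 2 \<noteq> 0" "w + 1 / 2 \<noteq> 0"
    unfolding zero_less_norm_iff by blast+
  have "1 / w\<^sup>2 - (1 / (w - 1 / 2) - 1 / (w + 1 / 2)) = (- 1 / 4) / (w\<^sup>2 * ((w - 1 / 2) * (w + 1 / 2)))"
  proof -
    have "1 / (w - 1 / 2) - 1 / (w + 1 / 2) = 1 / ((w - 1 / 2) * (w + 1 / 2))"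
      using nz(2,3) by (simp add: diff_frac_eq)
    then show ?thesis
      using nz by (simp only: diff_frac_eq mult_eq_0_iff power_eq_0_iff simp_thms)
        (simp add: field_simps power2_eq_square)
  qed
  then have "norm (1 / w\<^sup>2 - (1 / (w - 1 / 2) - 1 / (w + 1 / 2))) =
      (1 / 4) / (norm w ^ 2 * (norm (w - 1 / 2) * norm (w + 1 / 2)))"
    by (simp add: norm_mult norm_divide norm_power)
  also have "\<dots> \<le> (1 / 4) / (norm w ^ 2 * (norm w / 2 * (norm w / 2)))"
    using w by (intro divide_left_mono mult_left_mono mult_mono 1 2 mult_pos_pos) (use nz in auto)
  also have "\<dots> = 1 / norm w ^ 4"
    using w by (simp add: divide_simps power2_eq_square power4_eq_xxxx)
  also have "\<dots> \<le> 1 / norm w ^ 3"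
    using w by (intro divide_left_mono power_increasing) auto
  finally show "norm (case (m, n) of (m, n) \<Rightarrow> 1 / (of_int m * \<tau> + of_int n)\<^sup>2 -
      (1 / (of_int m * \<tau> + of_int n - 1 / 2) - 1 / (of_int m * \<tau> + of_int n + 1 / 2)))
      \<le> 1 / norm (of_int m * \<tau> + of_int n) ^ 3"
    by (simp add: w_def)
qed

section \<open>The shape of a symmetric convex body\<close>

text \<open>The four reflections of \<open>(p, q)\<close> are the corners of a rectangle in \<open>K\<close>; an interior point is
  reached by interpolating first horizontally and then vertically.\<close>

lemma symmetric_convex_body_subrectangle:
  assumes K: "K \<in> symmetric_convex_bodies" and pq: "(p, q) \<in> K"
    and x: "\<bar>x\<bar> \<le> \<bar>p\<bar>" and y: "\<bar>y\<bar> \<le> \<bar>q\<bar>"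
  shows "(x, y) \<in> K"
proof -
  have cvx: "convex K"
    and sym: "\<And>x y. (x, y) \<in> K \<Longrightarrow> (- x, y) \<in> K \<and> (x, - y) \<in> K"
    using K by (auto simp: symmetric_convex_bodies_def)
  have combination: "\<exists>u\<ge>0. u \<le> 1 \<and> t = (1 - u) * (- s) + u * s" if "\<bar>t\<bar> \<le> \<bar>s\<bar>" for s t :: real
  proof (cases "s = 0")
    case False
    then have "\<bar>t / s\<bar> \<le> 1"
      using that by simp
    then have "t / s \<le> 1" "- (t / s) \<le> 1"
      unfolding abs_le_iff by blast+
    then have "(t / s + 1) / 2 \<ge> 0" "(t / s + 1) / 2 \<le> 1"
      by simp_all
    moreover have "t = (1 - (t / s + 1) / 2) * (- s) + (t / s + 1) / 2 * s"
      using False by (simp add: field_simps)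
    ultimately show ?thesis by blast
  qed (use that in auto)
  obtain u where u: "u \<ge> 0" "u \<le> 1" "x = (1 - u) * (- p) + u * p"
    using combination[OF x] by blast
  have "(x, q) = (1 - u) *\<^sub>R (- p, q) + u *\<^sub>R (p, q)"
    using u by (simp add: algebra_simps)
  also have "\<dots> \<in> K"
    using sym[OF pq] pq u by (intro convexD_alt[OF cvx]) auto
  finally have xq: "(x, q) \<in> K" .
  obtain v where v: "v \<ge> 0" "v \<le> 1" "y = (1 - v) * (- q) + v * q"
    using combination[OF y] by blast
  have "(x, y) = (1 - v) *\<^sub>R (x, - q) + v *\<^sub>R (x, q)"
    using v by (simp add: algebra_simps)
  also have "\<dots> \<in> K"
    using sym[OF xq] xq v by (intro convexD_alt[OF cvx]) auto
  finally show ?thesis .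
qed

lemma symmetric_convex_body_contains_square:
  assumes K: "K \<in> symmetric_convex_bodies"
  obtains r where "r > 0" "\<And>x y. \<bar>x\<bar> \<le> r \<Longrightarrow> \<bar>y\<bar> \<le> r \<Longrightarrow> (x, y) \<in> K"
proof -
  have "interior K \<noteq> {}"
    using K by (auto simp: symmetric_convex_bodies_def)
  then obtain c where "c \<in> interior K"
    by blast
  then obtain e where e: "e > 0" "ball c e \<subseteq> K"
    using mem_interior by metis
  obtain c1 c2 where c: "c = (c1, c2)"
    by force
  \<comment> \<open>Move from the centre of the ball away from both axes, so that neither coordinate vanishes.\<close>
  define p where "p = (if c1 \<ge> 0 then c1 + e / 3 else c1 - e / 3)"
  define q where "q = (if c2 \<ge> 0 then c2 + e / 3 else c2 - e / 3)"
  have "dist c (p, q) \<le> \<bar>c1 - p\<bar> + \<bar>c2 - q\<bar>"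
    using norm_Pair_le[of "c1 - p" "c2 - q"] by (simp add: c dist_norm)
  also have "\<dots> < e"
    using e by (simp add: p_def q_def)
  finally have pq: "(p, q) \<in> K"
    using e by auto
  have "e / 3 \<le> \<bar>p\<bar>" "e / 3 \<le> \<bar>q\<bar>"
    using e by (auto simp: p_def q_def)
  then have "(x, y) \<in> K" if "\<bar>x\<bar> \<le> e / 3" "\<bar>y\<bar> \<le> e / 3" for x y
    using that by (intro symmetric_convex_body_subrectangle[OF K pq]) auto
  with e show ?thesis
    by (intro that[of "e / 3"]) auto
qed

text \<open>The profile \<open>h\<close> is concave because \<open>K\<close> is convex, hence continuous in the open interval. The two end
  points form a null set, so this is enough for pointwise convergence almost everywhere.\<close>

lemma symmetric_convex_body_profile:
  assumes K: "K \<in> symmetric_convex_bodies"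
  obtains a h where "K = {(x, y). \<bar>x\<bar> \<le> a \<and> \<bar>y\<bar> \<le> h x}"
    and "\<And>x. \<bar>x\<bar> \<le> a \<Longrightarrow> 0 \<le> h x"
    and "continuous_on {- a<..<a} h"
proof -
  have cpt: "compact K" and cvx: "convex K"
    and sym: "\<And>x y. (x, y) \<in> K \<Longrightarrow> (- x, y) \<in> K \<and> (x, - y) \<in> K"
    using K by (auto simp: symmetric_convex_bodies_def)
  have "K \<noteq> {}"
    using K interior_subset by (auto simp: symmetric_convex_bodies_def)
  then obtain P where P: "P \<in> K" "\<And>Q. Q \<in> K \<Longrightarrow> fst Q \<le> fst P"
    using continuous_attains_sup[OF cpt, of fst] continuous_on_fst[OF continuous_on_id] by blast
  define a where "a = fst P"
  have Kx: "\<bar>x\<bar> \<le> a" if "(x, y) \<in> K" for x y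
    using P(2)[OF that] P(2)[of "(- x, y)"] sym[OF that] by (auto simp: a_def)
  have "(a, snd P) \<in> K"
    using P(1) by (simp add: a_def)
  then have base: "(x, 0) \<in> K" if "\<bar>x\<bar> \<le> a" for x
    by (rule symmetric_convex_body_subrectangle[OF K]) (use that in simp_all)
  have "\<exists>t. (x, t) \<in> K \<and> (\<forall>y. (x, y) \<in> K \<longrightarrow> y \<le> t)" if "\<bar>x\<bar> \<le> a" for x
  proof -
    have "compact (K \<inter> {x} \<times> UNIV)"
      using cpt by (intro compact_Int_closed closed_Times) auto
    moreover have "K \<inter> {x} \<times> UNIV \<noteq> {}"
      using base[OF that] by blast
    ultimately obtain Q where "Q \<in> K \<inter> {x} \<times> UNIV" "\<forall>R\<in>K \<inter> {x} \<times> UNIV. snd R \<le> snd Q"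
      using continuous_attains_sup[of "K \<inter> {x} \<times> UNIV" snd]
        continuous_on_snd[OF continuous_on_id] by blast
    then have "(x, snd Q) \<in> K" "\<forall>y. (x, y) \<in> K \<longrightarrow> y \<le> snd Q"
      by (cases Q; force)+
    then show ?thesis
      by blast
  qed
  then have "\<forall>x\<in>{x. \<bar>x\<bar> \<le> a}. \<exists>t. (x, t) \<in> K \<and> (\<forall>y. (x, y) \<in> K \<longrightarrow> y \<le> t)"
    by simp
  from bchoice[OF this] obtain h
    where "\<forall>x\<in>{x. \<bar>x\<bar> \<le> a}. (x, h x) \<in> K \<and> (\<forall>y. (x, y) \<in> K \<longrightarrow> y \<le> h x)"
    by (elim exE)
  then have h: "\<And>x. \<bar>x\<bar> \<le> a \<Longrightarrow> (x, h x) \<in> K"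
    and h_max: "\<And>x y. \<bar>x\<bar> \<le> a \<Longrightarrow> (x, y) \<in> K \<Longrightarrow> y \<le> h x"
    by simp_all
  have h_nonneg: "0 \<le> h x" if "\<bar>x\<bar> \<le> a" for x
    using h_max[OF that base[OF that]] .
  have "K = {(x, y). \<bar>x\<bar> \<le> a \<and> \<bar>y\<bar> \<le> h x}"
  proof (intro set_eqI iffI)
    fix p assume "p \<in> K"
    then obtain x y where p: "p = (x, y)" and xy: "(x, y) \<in> K"
      by (cases p) simp
    have "y \<le> h x" "- y \<le> h x"
      using h_max[OF Kx[OF xy]] xy sym[OF xy] by auto
    then show "p \<in> {(x, y). \<bar>x\<bar> \<le> a \<and> \<bar>y\<bar> \<le> h x}"
      using Kx[OF xy] by (simp add: p)
  next
    fix p assume "p \<in> {(x, y). \<bar>x\<bar> \<le> a \<and> \<bar>y\<bar> \<le> h x}"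
    then obtain x y where p: "p = (x, y)" and xy: "\<bar>x\<bar> \<le> a" "\<bar>y\<bar> \<le> h x"
      by blast
    show "p \<in> K"
      unfolding p using xy h_nonneg[OF xy(1)]
      by (intro symmetric_convex_body_subrectangle[OF K h[OF xy(1)]]) simp_all
  qed
  moreover have "continuous_on {- a<..<a} h"
  proof -
    have "convex_on {- a<..<a} (\<lambda>x. - h x)"
    proof (rule convex_onI)
      fix t x y :: real
      assume t: "0 < t" "t < 1" and xy: "x \<in> {- a<..<a}" "y \<in> {- a<..<a}"
      have "(1 - t) *\<^sub>R (x, h x) + t *\<^sub>R (y, h y) \<in> K"
        using t xy by (intro convexD_alt[OF cvx] h) auto
      then have "((1 - t) * x + t * y, (1 - t) * h x + t * h y) \<in> K"
        by simp
      then have "(1 - t) * h x + t * h y \<le> h ((1 - t) * x + t * y)"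
        using h_max Kx by blast
      then show "- h ((1 - t) *\<^sub>R x + t *\<^sub>R y) \<le> (1 - t) * - h x + t * - h y"
        by simp
    qed simp
    then have "continuous_on {- a<..<a} (\<lambda>x. - h x)"
      by (intro convex_on_continuous) auto
    then show ?thesis
      using continuous_on_minus by fastforce
  qed
  ultimately show ?thesis
    using h_nonneg that by blast
qed

section \<open>Dilated lattice points and absolutely convergent families\<close>

lemma mem_dilated_lattice_points_iff:
  assumes "l > 0"
  shows "(m, n) \<in> dilated_lattice_points K l \<longleftrightarrow> (of_int m / l, of_int n / l) \<in> K"
proof -
  have "(of_int m, of_int n) \<in> (\<lambda>p. l *\<^sub>R p) ` K \<longleftrightarrow>
      (1 / l) *\<^sub>R (of_int m :: real, of_int n :: real) \<in> K"
  proof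
    assume "(1 / l) *\<^sub>R (of_int m :: real, of_int n :: real) \<in> K"
    moreover have "(of_int m, of_int n) = l *\<^sub>R (1 / l) *\<^sub>R (of_int m :: real, of_int n :: real)"
      using assms by simp
    ultimately show "(of_int m, of_int n) \<in> (\<lambda>p. l *\<^sub>R p) ` K"
      by blast
  qed (use assms in auto)
  then show ?thesis
    by (simp add: dilated_lattice_points_def)
qed

lemma filterlim_dilated_lattice_points:
  assumes K: "K \<in> symmetric_convex_bodies"
  shows "filterlim (dilated_lattice_points K) (finite_subsets_at_top UNIV) at_top"
  unfolding filterlim_finite_subsets_at_top
proof (intro allI impI)
  fix X :: "(int \<times> int) set"
  assume X: "finite X \<and> X \<subseteq> UNIV"
  obtain r where r: "r > 0" "\<And>x y. \<bar>x\<bar> \<le> r \<Longrightarrow> \<bar>y\<bar> \<le> r \<Longrightarrow> (x, y) \<in> K"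
    using symmetric_convex_body_contains_square[OF K] by metis
  have "eventually (\<lambda>l. p \<in> dilated_lattice_points K l) at_top" for p
  proof -
    obtain m n where p: "p = (m, n)" by force
    show ?thesis
      using eventually_gt_at_top[of 0] eventually_ge_at_top[of "\<bar>of_int m\<bar> / r"]
        eventually_ge_at_top[of "\<bar>of_int n\<bar> / r"]
    proof eventually_elim
      case (elim l)
      then show ?case
        unfolding p mem_dilated_lattice_points_iff[OF elim(1)]
        using r(1) by (intro r(2)) (auto simp: field_simps)
    qed
  qed
  then have "eventually (\<lambda>l. \<forall>p\<in>X. p \<in> dilated_lattice_points K l) at_top"
    using X by (intro eventually_ball_finite) auto
  moreover have "finite (dilated_lattice_points K l)" for l
    using K by (intro finite_dilated_lattice_points compact_imp_bounded)
      (auto simp: symmetric_convex_bodies_def)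
  ultimately show "\<forall>\<^sub>F l in at_top. finite (dilated_lattice_points K l) \<and>
      X \<subseteq> dilated_lattice_points K l \<and> dilated_lattice_points K l \<subseteq> UNIV"
    by (auto elim: eventually_mono)
qed

lemma K_partial_sum_tendsto_infsum:
  assumes "K \<in> symmetric_convex_bodies" and "(\<lambda>(m, n). f m n) summable_on UNIV"
  shows "(K_partial_sum K f \<longlongrightarrow> infsum (\<lambda>(m, n). f m n) UNIV) at_top"
proof -
  have "(sum (\<lambda>(m, n). f m n) \<longlongrightarrow> infsum (\<lambda>(m, n). f m n) UNIV) (finite_subsets_at_top UNIV)"
    using has_sum_infsum[OF assms(2)] by (simp add: has_sum_def)
  from filterlim_compose[OF this filterlim_dilated_lattice_points[OF assms(1)]]
  show ?thesis
    by (simp add: K_partial_sum_def[abs_def])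
qed

lemma K_partial_sum_diff:
  "K_partial_sum K f l - K_partial_sum K g l = K_partial_sum K (\<lambda>m n. f m n - g m n) l"
  by (simp add: K_partial_sum_def sum_subtractf split_def)

section \<open>Row sums of the telescoping terms\<close>

text \<open>This is the value of a telescoped row: \<open>x\<close> is the row index, and \<open>\<plusminus> y\<close> are the two ends of the row,
  which lie half a unit beyond its outermost lattice points.\<close>

definition edge_kernel :: "complex \<Rightarrow> real \<Rightarrow> real \<Rightarrow> complex" where
  "edge_kernel \<tau> x y = 1 / (of_real x * \<tau> - of_real y) - 1 / (of_real x * \<tau> + of_real y)"

lemma edge_kernel_homogeneous:
  assumes "l \<noteq> 0"
  shows "l *\<^sub>R edge_kernel \<tau> x y = edge_kernel \<tau> (x / l) (y / l)"
proof -
  have "of_real (x / l) * \<tau> - of_real (y / l) = (of_real x * \<tau> - of_real y) / of_real l"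
    "of_real (x / l) * \<tau> + of_real (y / l) = (of_real x * \<tau> + of_real y) / of_real l"
    by (simp_all add: diff_divide_distrib add_divide_distrib)
  then show ?thesis
    by (simp add: edge_kernel_def scaleR_conv_of_real right_diff_distrib)
qed

lemma norm_edge_kernel_bound:
  assumes "Im \<tau> > 0"
  obtains B where "B > 0"
    and "\<And>x y c. 0 < c \<Longrightarrow> c \<le> \<bar>x\<bar> + \<bar>y\<bar> \<Longrightarrow> norm (edge_kernel \<tau> x y) \<le> B / c"
proof -
  obtain B where B: "B > 0"
    and coords: "\<And>x y :: real. \<bar>x\<bar> + \<bar>y\<bar> \<le> B * norm (of_real x * \<tau> + of_real y)"
    using abs_coords_le_norm[OF assms] by metis
  have reciprocal: "norm (1 / (of_real x * \<tau> + of_real y)) \<le> B / c"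
    if "0 < c" "c \<le> \<bar>x\<bar> + \<bar>y\<bar>" for x y c
  proof -
    have c: "c \<le> B * norm (of_real x * \<tau> + of_real y)"
      using coords[of x y] that by linarith
    then have "norm (of_real x * \<tau> + of_real y) > 0"
      using B that by (metis leD mult_zero_right norm_ge_zero order_less_le)
    with c that B show ?thesis
      by (simp add: norm_divide divide_simps mult_ac)
  qed
  show ?thesis
  proof (rule that)
    show "2 * B > 0"
      using B by simp
    fix x y c :: real
    assume c: "0 < c" "c \<le> \<bar>x\<bar> + \<bar>y\<bar>"
    have "norm (edge_kernel \<tau> x y) \<le>
        norm (1 / (of_real x * \<tau> + of_real (- y))) + norm (1 / (of_real x * \<tau> + of_real y))"
      unfolding edge_kernel_def using norm_triangle_ineq4 by (metis diff_conv_add_uminus of_real_minus)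
    also have "\<dots> \<le> B / c + B / c"
      using c by (intro add_mono reciprocal) auto
    finally show "norm (edge_kernel \<tau> x y) \<le> 2 * B / c"
      by simp
  qed
qed

lemma tendsto_edge_kernel:
  assumes "Im \<tau> > 0" and "(f \<longlongrightarrow> x) F" "(g \<longlongrightarrow> y) F" and "x \<noteq> 0 \<or> y \<noteq> 0"
  shows "((\<lambda>t. edge_kernel \<tau> (f t) (g t)) \<longlongrightarrow> edge_kernel \<tau> x y) F"
proof -
  have "of_real x * \<tau> + of_real y \<noteq> 0" "of_real x * \<tau> - of_real y \<noteq> 0"
    using of_real_linear_combination_nonzero[OF assms(1), of x y]
      of_real_linear_combination_nonzero[OF assms(1), of x "- y"] assms(4) by auto
  then show ?thesis
    unfolding edge_kernel_def by (intro tendsto_intros assms(2,3))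
qed

lemma telescoping_row_sum:
  fixes w :: "'a :: real_normed_field"
  assumes "N \<ge> 0"
  shows "(\<Sum>n\<in>{- N..N}. 1 / (w + of_int n - 1 / 2) - 1 / (w + of_int n + 1 / 2)) =
    1 / (w - (of_int N + 1 / 2)) - 1 / (w + (of_int N + 1 / 2))"
  using assms
proof (induction N rule: int_ge_induct)
  case base
  then show ?case by simp
next
  case (step N)
  have "{- (N + 1)..N + 1} = insert (- (N + 1)) (insert (N + 1) {- N..N})"
    using step.hyps by auto
  then show ?case
    using step by (simp add: algebra_simps)
qed

section \<open>Riemann sums as integrals of step functions\<close>

text \<open>Rewriting a sum over \<open>m\<close> as the integral of a step function with steps of width \<open>1 / l\<close> makes
  dominated convergence available for Riemann sums.\<close>

lemma sum_eq_integral_floor: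
  fixes R :: "int \<Rightarrow> 'a :: {banach, second_countable_topology}"
  assumes "finite M" and outside: "\<And>m. m \<notin> M \<Longrightarrow> R m = 0" and l: "l > 0"
  shows "(\<integral>x. l *\<^sub>R R \<lfloor>l * x\<rfloor> \<partial>lborel) = sum R M"
proof -
  define J where "J = (\<lambda>m::int. {of_int m / l..<(of_int m + 1) / l})"
  have J: "x \<in> J m \<longleftrightarrow> m = \<lfloor>l * x\<rfloor>" for x m
  proof -
    have "x \<in> J m \<longleftrightarrow> of_int m \<le> l * x \<and> l * x < of_int m + 1"
      using l by (simp add: J_def field_simps)
    also have "\<dots> \<longleftrightarrow> m = \<lfloor>l * x\<rfloor>"
      using floor_eq_iff[of "l * x" m] by auto
    finally show ?thesis .
  qed
  have "l *\<^sub>R R \<lfloor>l * x\<rfloor> = (\<Sum>m\<in>M. indicator (J m) x *\<^sub>R (l *\<^sub>R R m))" for x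
  proof -
    have "indicator (J m) x *\<^sub>R (l *\<^sub>R R m) = (if m = \<lfloor>l * x\<rfloor> then l *\<^sub>R R m else 0)" for m
      by (simp add: indicator_def J)
    then show ?thesis
      using assms(1) outside[of "\<lfloor>l * x\<rfloor>"] by simp
  qed
  moreover have "has_bochner_integral lborel (\<lambda>x. \<Sum>m\<in>M. indicator (J m) x *\<^sub>R (l *\<^sub>R R m))
      (\<Sum>m\<in>M. measure lborel (J m) *\<^sub>R (l *\<^sub>R R m))"
    using l by (intro has_bochner_integral_sum has_bochner_integral_indicator)
      (auto simp: J_def divide_right_mono)
  moreover have "measure lborel (J m) *\<^sub>R (l *\<^sub>R R m) = R m" for m
    using l by (simp add: J_def divide_right_mono field_simps)
  ultimately show ?thesis
    by (simp add: has_bochner_integral_integral_eq)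
qed

lemma tendsto_floor_scaled:
  fixes f :: "real \<Rightarrow> real"
  assumes "(f \<longlongrightarrow> c) at_top"
  shows "((\<lambda>l. of_int \<lfloor>l * f l\<rfloor> / l) \<longlongrightarrow> c) at_top"
proof (rule tendsto_sandwich)
  show "eventually (\<lambda>l. f l - 1 / l \<le> of_int \<lfloor>l * f l\<rfloor> / l) at_top"
    using eventually_gt_at_top[of 0]
  proof eventually_elim
    case (elim l)
    have "(l * f l - 1) / l \<le> of_int \<lfloor>l * f l\<rfloor> / l"
      using elim by (intro divide_right_mono) linarith+
    then show ?case
      using elim by (simp add: diff_divide_distrib)
  qed
  show "eventually (\<lambda>l. of_int \<lfloor>l * f l\<rfloor> / l \<le> f l) at_top"
    using eventually_gt_at_top[of 0]
  proof eventually_elim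
    case (elim l)
    then have "of_int \<lfloor>l * f l\<rfloor> / l \<le> l * f l / l"
      by (intro divide_right_mono) auto
    then show ?case
      using elim by simp
  qed
  have "((\<lambda>l::real. 1 / l) \<longlongrightarrow> 0) at_top"
    using tendsto_inverse_0_at_top[OF filterlim_ident]
    by (simp add: inverse_eq_divide)
  from tendsto_diff[OF assms this] show "((\<lambda>l. f l - 1 / l) \<longlongrightarrow> c) at_top"
    by simp
qed (fact assms)

section \<open>Summation over dilated bodies\<close>

text \<open>The partial sum over \<open>l K\<close> is the integral of the step function with value
  \<open>l * k m (N + 1/2) = k (m / l) ((N + 1/2) / l)\<close> at \<open>x\<close>, where \<open>m = \<lfloor>l * x\<rfloor>\<close>, \<open>N = \<lfloor>l * h (m / l)\<rfloor>\<close> and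
  \<open>k\<close> is the edge kernel. For \<open>\<bar>x\<bar> < a\<close> the arguments tend to \<open>x\<close> and \<open>h x\<close>. They stay away from the
  origin because \<open>K\<close> contains a square around it, so the integrands are bounded uniformly in \<open>l\<close>, and
  they vanish outside a fixed interval. Dominated convergence then yields a limit.\<close>

lemma telescoped_terms_K_summable:
  assumes K: "K \<in> symmetric_convex_bodies" and \<tau>: "Im \<tau> > 0"
  shows "K_summable K (\<lambda>m n. 1 / (of_int m * \<tau> + of_int n - 1 / 2) -
    1 / (of_int m * \<tau> + of_int n + 1 / 2))" (is "K_summable K ?g")
proof -
  obtain a h where profile: "K = {(x, y). \<bar>x\<bar> \<le> a \<and> \<bar>y\<bar> \<le> h x}"
    and h_nonneg: "\<And>x. \<bar>x\<bar> \<le> a \<Longrightarrow> 0 \<le> h x"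
    and h_cont: "continuous_on {- a<..<a} h"
    by (fact symmetric_convex_body_profile[OF K])
  obtain r where r: "r > 0" and square: "\<And>x y. \<bar>x\<bar> \<le> r \<Longrightarrow> \<bar>y\<bar> \<le> r \<Longrightarrow> (x, y) \<in> K"
    by (fact symmetric_convex_body_contains_square[OF K])
  have h_ge: "r \<le> h x" if "\<bar>x\<bar> \<le> r" for x
    using square[OF that, of r] r by (simp add: profile)
  obtain B where B: "B > 0"
    and kernel: "\<And>x y c. 0 < c \<Longrightarrow> c \<le> \<bar>x\<bar> + \<bar>y\<bar> \<Longrightarrow> norm (edge_kernel \<tau> x y) \<le> B / c"
    by (fact norm_edge_kernel_bound[OF \<tau>])
  define N where "N = (\<lambda>l m. \<lfloor>l * h (of_int m / l)\<rfloor>)"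
  define R where "R = (\<lambda>l m. if \<bar>of_int m\<bar> \<le> l * a
    then edge_kernel \<tau> (of_int m) (of_int (N l m) + 1 / 2) else 0)"

  have partial_sum: "K_partial_sum K ?g l = (\<integral>x. l *\<^sub>R R l \<lfloor>l * x\<rfloor> \<partial>lborel)" if l: "l > 0" for l
  proof -
    define M where "M = {m::int. \<bar>of_int m\<bar> \<le> l * a}"
    have "M \<subseteq> {- \<lfloor>l * a\<rfloor>..\<lfloor>l * a\<rfloor>}"
      by (auto simp: M_def; linarith)
    then have M: "finite M"
      by (rule finite_subset) simp
    have points: "dilated_lattice_points K l = (SIGMA m:M. {- N l m..N l m})"
    proof (intro set_eqI)
      fix p :: "int \<times> int"
      obtain m n where p: "p = (m, n)" by force
      have "p \<in> dilated_lattice_points K l \<longleftrightarrow>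
          \<bar>of_int m\<bar> \<le> l * a \<and> \<bar>of_int n\<bar> \<le> l * h (of_int m / l)"
        using l by (simp add: p mem_dilated_lattice_points_iff profile field_simps)
      also have "\<bar>of_int n\<bar> \<le> l * h (of_int m / l) \<longleftrightarrow> \<bar>n\<bar> \<le> N l m"
        by (simp add: N_def le_floor_iff)
      finally show "p \<in> dilated_lattice_points K l \<longleftrightarrow> p \<in> (SIGMA m:M. {- N l m..N l m})"
        by (auto simp: p M_def)
    qed
    have row: "(\<Sum>n\<in>{- N l m..N l m}. ?g m n) = R l m" if "m \<in> M" for m
    proof -
      have "0 \<le> N l m"
        using that l h_nonneg[of "of_int m / l"] by (simp add: N_def M_def field_simps)
      from telescoping_row_sum[OF this, of "of_int m * \<tau>"] that show ?thesis
        by (simp add: R_def M_def edge_kernel_def)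
    qed
    have "K_partial_sum K ?g l = (\<Sum>m\<in>M. \<Sum>n\<in>{- N l m..N l m}. ?g m n)"
      unfolding K_partial_sum_def points using M by (subst sum.Sigma) auto
    also have "\<dots> = sum (R l) M"
      using row by simp
    also have "\<dots> = (\<integral>x. l *\<^sub>R R l \<lfloor>l * x\<rfloor> \<partial>lborel)"
      using M l by (intro sum_eq_integral_floor[symmetric]) (auto simp: M_def R_def)
    finally show ?thesis .
  qed

  have "((\<lambda>l. \<integral>x. l *\<^sub>R R l \<lfloor>l * x\<rfloor> \<partial>lborel) \<longlongrightarrow>
      (\<integral>x. indicator {- a<..<a} x *\<^sub>R edge_kernel \<tau> x (h x) \<partial>lborel)) at_top"
  proof (rule integral_dominated_convergence_at_top)
    have "0 < \<bar>x\<bar> \<or> 0 < h x" for x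
      using h_ge[of x] r by (cases "x = 0") auto
    then have nonzero: "x \<noteq> 0 \<or> h x \<noteq> 0" for x
      by (metis abs_zero less_irrefl)
    have "continuous_on {- a<..<a} (\<lambda>x. edge_kernel \<tau> x (h x))"
      using h_cont nonzero unfolding continuous_on_def by (auto intro!: tendsto_edge_kernel[OF \<tau>])
    then show "(\<lambda>x. indicator {- a<..<a} x *\<^sub>R edge_kernel \<tau> x (h x)) \<in> borel_measurable lborel"
      using borel_measurable_continuous_on_indicator[of "{- a<..<a}" "\<lambda>x. edge_kernel \<tau> x (h x)"]
      by simp
    show "(\<lambda>x. l *\<^sub>R R l \<lfloor>l * x\<rfloor>) \<in> borel_measurable lborel" for l
      by measurable
    show "integrable lborel (\<lambda>x. indicator {- (a + 1)..a + 1} x *\<^sub>R (2 * B / r))"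
      by (intro integrable_indicator) (auto simp: emeasure_lborel_Icc_eq)
    show "\<forall>\<^sub>F l in at_top. AE x in lborel.
        norm (l *\<^sub>R R l \<lfloor>l * x\<rfloor>) \<le> indicator {- (a + 1)..a + 1} x *\<^sub>R (2 * B / r)"
      using eventually_ge_at_top[of 1] eventually_ge_at_top[of "1 / r"]
    proof eventually_elim
      case (elim l)
      then have l: "l > 0" "l \<ge> 1" "l * r \<ge> 1"
        using r by (auto simp: field_simps)
      have bound: "norm (l *\<^sub>R R l m) \<le> 2 * B / r" if m: "\<bar>of_int m\<bar> \<le> l * a" for m
      proof -
        define u where "u = of_int m / l"
        define v where "v = (of_int (N l m) + 1 / 2) / l"
        \<comment> \<open>Either the row index is large, or the row meets the square and so is long. The loss from
          \<open>r\<close> to \<open>r / 2\<close> absorbs the rounding in \<open>N\<close>.\<close>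
        have "r / 2 \<le> \<bar>u\<bar> + \<bar>v\<bar>"
        proof (cases "\<bar>u\<bar> \<le> r")
          case True
          then have "l * r \<le> l * h u"
            using h_ge l by (intro mult_left_mono) auto
          then have "l * (r / 2) \<le> of_int (N l m) + 1 / 2"
            using l(3) unfolding N_def u_def by simp linarith
          then have "r / 2 \<le> v"
            using l by (simp add: v_def field_simps)
          then show ?thesis by linarith
        next
          case False
          then show ?thesis using r by linarith
        qed
        then have "norm (edge_kernel \<tau> u v) \<le> B / (r / 2)"
          using r by (intro kernel) auto
        moreover have "l *\<^sub>R R l m = edge_kernel \<tau> u v"
          using m l(1) by (simp add: R_def edge_kernel_homogeneous u_def v_def)
        ultimately show ?thesis
          by (simp add: mult.commute)
      qed
      have outside: "R l \<lfloor>l * x\<rfloor> = 0" if "x \<notin> {- (a + 1)..a + 1}" for x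
      proof -
        have "l * x > l * (a + 1) \<or> l * x < l * (- (a + 1))"
          using that l(1) by (auto simp: mult_less_cancel_left_pos)
        then have "\<not> \<bar>of_int \<lfloor>l * x\<rfloor>\<bar> \<le> l * a"
          using l by (simp add: algebra_simps) linarith
        then show ?thesis
          by (simp add: R_def)
      qed
      have "norm (l *\<^sub>R R l m) \<le> 2 * B / r" for m
      proof (cases "\<bar>of_int m\<bar> \<le> l * a")
        case False
        then have "R l m = 0"
          by (simp add: R_def)
        then show ?thesis
          using B r by simp
      qed (rule bound)
      then show ?case
        using outside by (intro AE_I2) (simp add: indicator_def)
    qed
    show "AE x in lborel. ((\<lambda>l. l *\<^sub>R R l \<lfloor>l * x\<rfloor>) \<longlongrightarrow>
        indicator {- a<..<a} x *\<^sub>R edge_kernel \<tau> x (h x)) at_top"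
      using AE_lborel_singleton[of a] AE_lborel_singleton[of "- a"]
    proof eventually_elim
      case (elim x)
      have u: "((\<lambda>l. of_int \<lfloor>l * x\<rfloor> / l) \<longlongrightarrow> x) at_top"
        by (intro tendsto_floor_scaled tendsto_const)
      show ?case
      proof (cases "\<bar>x\<bar> < a")
        case True
        then have x: "x \<in> {- a<..<a}"
          by auto
        then have "isCont h x"
          using h_cont by (simp add: continuous_on_eq_continuous_at)
        from tendsto_floor_scaled[OF isCont_tendsto_compose[OF this u]]
        have "((\<lambda>l. of_int (N l \<lfloor>l * x\<rfloor>) / l) \<longlongrightarrow> h x) at_top"
          by (simp add: N_def)
        moreover have "((\<lambda>l::real. 1 / 2 * inverse l) \<longlongrightarrow> 1 / 2 * 0) at_top"
          by (intro tendsto_mult tendsto_const tendsto_inverse_0_at_top filterlim_ident)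
        ultimately have "((\<lambda>l. of_int (N l \<lfloor>l * x\<rfloor>) / l + 1 / 2 * inverse l)
            \<longlongrightarrow> h x + 1 / 2 * 0) at_top"
          by (rule tendsto_add)
        then have v: "((\<lambda>l. (of_int (N l \<lfloor>l * x\<rfloor>) + 1 / 2) / l) \<longlongrightarrow> h x) at_top"
          by (simp add: add_divide_distrib inverse_eq_divide mult.commute)
        have "eventually (\<lambda>l. l *\<^sub>R R l \<lfloor>l * x\<rfloor> = edge_kernel \<tau>
            (of_int \<lfloor>l * x\<rfloor> / l) ((of_int (N l \<lfloor>l * x\<rfloor>) + 1 / 2) / l)) at_top"
          using topological_tendstoD[OF u open_greaterThanLessThan x] eventually_gt_at_top[of 0]
        proof eventually_elim
          case (elim l)
          then have "\<bar>of_int \<lfloor>l * x\<rfloor>\<bar> \<le> l * a"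
            by (simp add: field_simps abs_le_iff)
          then show ?case
            using elim by (simp add: R_def edge_kernel_homogeneous)
        qed
        then have "((\<lambda>l. l *\<^sub>R R l \<lfloor>l * x\<rfloor>) \<longlongrightarrow> edge_kernel \<tau> x (h x)) at_top"
          using tendsto_edge_kernel[OF \<tau> u v nonzero] by (simp add: tendsto_cong)
        then show ?thesis
          using x by simp
      next
        case False
        then have "x \<in> - {- a..a}"
          using elim by auto
        from topological_tendstoD[OF u _ this]
        have "eventually (\<lambda>l. of_int \<lfloor>l * x\<rfloor> / l \<in> - {- a..a}) at_top"
          by auto
        then have "eventually (\<lambda>l. l *\<^sub>R R l \<lfloor>l * x\<rfloor> = 0) at_top"
          using eventually_gt_at_top[of 0]
        proof eventually_elim
          case (elim l)
          then have "\<not> \<bar>of_int \<lfloor>l * x\<rfloor>\<bar> \<le> l * a"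
            by (auto simp: field_simps abs_le_iff)
          then show ?case
            by (simp add: R_def)
        qed
        then have "((\<lambda>l. l *\<^sub>R R l \<lfloor>l * x\<rfloor>) \<longlongrightarrow> 0) at_top"
          by (rule tendsto_eventually)
        moreover have "x \<notin> {- a<..<a}"
          using False by auto
        ultimately show ?thesis
          by simp
      qed
    qed
  qed
  moreover have "eventually (\<lambda>l. (\<integral>x. l *\<^sub>R R l \<lfloor>l * x\<rfloor> \<partial>lborel) = K_partial_sum K ?g l) at_top"
    using eventually_gt_at_top[of 0] by eventually_elim (simp add: partial_sum)
  ultimately show ?thesis
    unfolding K_summable_def using Lim_transform_eventually by blast
qed

lemma eisenstein_terms_K_summable:
  assumes K: "K \<in> symmetric_convex_bodies" and \<tau>: "Im \<tau> > 0"
  shows "K_summable K (\<lambda>m n. 1 / (of_int m * \<tau> + of_int n)\<^sup>2)" (is "K_summable K ?f")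
proof -
  define g where "g = (\<lambda>m n. 1 / (of_int m * \<tau> + of_int n - 1 / 2) -
    1 / (of_int m * \<tau> + of_int n + 1 / 2))"
  obtain L where L: "(K_partial_sum K g \<longlongrightarrow> L) at_top"
    using telescoped_terms_K_summable[OF K \<tau>] by (auto simp: K_summable_def g_def)
  have "(\<lambda>(m, n). ?f m n - g m n) summable_on UNIV"
    unfolding g_def by (rule telescoping_difference_summable[OF \<tau>])
  from tendsto_add[OF K_partial_sum_tendsto_infsum[OF K this] L]
  show ?thesis
    unfolding K_summable_def by (auto simp flip: K_partial_sum_diff)
qed

theorem proposition9:
  fixes K :: "(real \<times> real) set" and \<tau> z :: complex
  assumes "K \<in> symmetric_convex_bodies"
    and "Im \<tau> > 0"
    and "z \<notin> period_lattice \<tau>"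
  shows "K_summable K (weierstrass_terms \<tau> z) \<and>
    weierstrass_p_K K \<tau> z = weierstrass_p \<tau> z + eisenstein_G2 \<tau> + residual_E K \<tau>"
proof -
  define f where "f = (\<lambda>m n. 1 / (of_int m * \<tau> + of_int n)\<^sup>2)"
  define d where "d = (\<lambda>m n. weierstrass_terms \<tau> z m n - f m n)"
  obtain L where L: "(K_partial_sum K f \<longlongrightarrow> L) at_top"
    using eisenstein_terms_K_summable[OF assms(1,2)] by (auto simp: K_summable_def f_def)
  \<comment> \<open>The convention \<open>a\<^bsub>0,0\<^esub> = 0\<close> agrees with \<open>1 / 0 = 0\<close>, so the case distinction disappears.\<close>
  have "(\<lambda>m n. if (m, n) = (0, 0) then 0 else 1 / (of_int m * \<tau> + of_int n)\<^sup>2) = f"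
    by (auto simp: f_def fun_eq_iff)
  then have G2: "eisenstein_G2_K K \<tau> = L"
    using tendsto_Lim[OF _ L] by (simp add: eisenstein_G2_K_def K_sum_def)
  have d: "(\<lambda>(m, n). d m n) summable_on UNIV"
    using weierstrass_difference_summable[OF assms(2), of z]
    by (simp add: d_def f_def weierstrass_terms_def add.commute)
  have "(\<lambda>(m, n). d m n) summable_on UNIV - {(0, 0)}"
    using d by (intro summable_on_cofin_subset) auto
  from infsum_insert[OF this, of "(0, 0)"]
  have "infsum (\<lambda>(m, n). d m n) UNIV = d 0 0 + infsum (\<lambda>(m, n). d m n) (UNIV - {(0, 0)})"
    by (simp add: insert_absorb)
  also have "\<dots> = weierstrass_p \<tau> z"
    by (simp add: weierstrass_p_def d_def f_def weierstrass_terms_def add.commute)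
  finally have p: "infsum (\<lambda>(m, n). d m n) UNIV = weierstrass_p \<tau> z" .
  have "(K_partial_sum K (weierstrass_terms \<tau> z) \<longlongrightarrow> weierstrass_p \<tau> z + L) at_top"
    using tendsto_add[OF K_partial_sum_tendsto_infsum[OF assms(1) d, unfolded p] L]
    by (simp add: d_def flip: K_partial_sum_diff)
  moreover from this have "weierstrass_p_K K \<tau> z = weierstrass_p \<tau> z + L"
    unfolding weierstrass_p_K_def K_sum_def by (intro tendsto_Lim) auto
  ultimately show ?thesis
    by (auto simp: K_summable_def residual_E_def G2)
qed

end
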